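(* There exists an integral curve $\gamma$ of length $5$ in $\mathbb{E}=\mathbb{R}^3$ which is not orientably cobordant to any unit rhombus $\rho$.
   Context: Let $\mathbb{E}$ denote three-dimensional Euclidean space. An integral curve is a closed piecewise linear curve in $\mathbb{E}$ all of whose intervals (edges) have unit length. For points $v_1,\dots,v_n\in\mathbb{E}$ with $|v_i-v_{i+1}|=1$ (convention $v_{n+1}=v_1$), $[v_1\dots v_n]$ denotes the integral curve with these consecutive vertices; its length is $n$, the sum of its edge lengths. $\mathcal{M}_n$ is the set of all integral curves of length $n$; elements of $\mathcal{M}_4$ are called unit rhombi (so a unit rhombus is any closed 4-gon with unit edges, not necessarily planar). Domes. Let $\gamma_1,\dots,\gamma_r$ be integral curves. A dome over $\gamma_1\cup\dots\cup\gamma_r$ is a piecewise linear complex in $\mathbb{E}$ whose facets are all unit equilateral triangles and whose boundary is $\gamma_1\cup\dots\cup\gamma_r$. It need not be embedded or immersed: it is the image of a finite abstract simplicial surface complex under a map to $\mathbb{E}$ that is isometric on unit edges and unit triangles. When the boundary curves share edges, the dome need not be purely 2-dimensional (it may contain edges lying in no triangle). The closure of an integral curve $\gamma_i$ is the surface formed by gluing the boundary of an (abstract) disk to $\gamma_i$. The dome is orientable if, combinatorially, the dome together with the closures of all of $\gamma_1,\dots,\gamma_r$ forms a closed orientable surface; equivalently, the underlying complex $S$ is contained in a closed orientable surface $\widehat{S}$ such that $\widehat{S}\smallsetminus S$ is a disjoint union of $r$ open disks whose boundary curves map to $\gamma_1,\dots,\gamma_r$. Two (unions of) integral curves $\gamma$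 and $\eta$ are cobordant if there is a dome over $\gamma\cup\eta$, and orientably cobordant if there is an orientable such dome. *)

theory Defs
  imports "HOL-Analysis.Analysis"
begin

section \<open>Integral curves\<close>

text \<open>The list \<open>[v\<^sub>1, \<dots>, v\<^sub>n]\<close> stands for the closed curve \<open>[v\<^sub>1 \<dots> v\<^sub>n]\<close> with \<open>v\<^sub>n\<^sub>+\<^sub>1 = v\<^sub>1\<close>.\<close>

definition integral_curves :: "nat \<Rightarrow> (real^3) list set" where
  "integral_curves n = {vs. length vs = n \<and> vs \<noteq> [] \<and>
     (\<forall>i<n. dist (vs ! i) (vs ! (Suc i mod n)) = 1)}"

abbreviation unit_rhombi :: "(real^3) list set" where
  "unit_rhombi \<equiv> integral_curves 4"


section \<open>Surfaces glued from polygons\<close>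

text \<open>A face is a polygon attached to a graph along a closed walk, given by the cyclic list of
  the vertices it visits. The walk may revisit vertices and edges.\<close>

definition sides :: "'v list \<Rightarrow> ('v \<times> 'v) list" where
  "sides f = zip f (rotate1 f)"

definition corners :: "'v list \<Rightarrow> ('v \<times> 'v \<times> 'v) list" where
  "corners f = zip f (zip (rotate 1 f) (rotate 2 f))"

text \<open>The link of a vertex \<open>v\<close> is a multigraph: its nodes are the neighbours of \<open>v\<close> and every
  corner \<open>(u, v, w)\<close> of a face contributes an edge between \<open>u\<close> and \<open>w\<close>.\<close>

definition link_rel :: "'v list list \<Rightarrow> 'v \<Rightarrow> ('v \<times> 'v) set" where
  "link_rel fs v = {(u, w). \<exists>f \<in> set fs. (u, v, w) \<in> set (corners f) \<or> (w, v, u) \<in> set (corners f)}"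

text \<open>The graph with vertices \<open>V\<close> and edges \<open>E\<close>, together with the faces \<open>fs\<close>, is a compact
  2-manifold without boundary. Each edge is covered by exactly two face sides, so every
  link is 2-regular; being connected, it is then a circle. As usual for cobordisms, the surface
  itself may be disconnected.\<close>

definition closed_surface :: "'v set \<Rightarrow> 'v set set \<Rightarrow> 'v list list \<Rightarrow> bool" where
  "closed_surface V E fs \<longleftrightarrow>
     finite V \<and>
     (\<forall>e\<in>E. e \<subseteq> V \<and> card e = 2) \<and>
     (\<forall>f\<in>set fs. f \<noteq> [] \<and> (\<forall>(u, v)\<in>set (sides f). {u, v} \<in> E)) \<and>
     (\<forall>e\<in>E. count_list (map (\<lambda>(u, v). {u, v}) (concat (map sides fs))) e = 2) \<and>
     (\<forall>v\<in>V. \<exists>u. {u, v} \<in> E) \<and>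
     (\<forall>v u w. {u, v} \<in> E \<and> {v, w} \<in> E \<longrightarrow> (u, w) \<in> (link_rel fs v)\<^sup>*)"

text \<open>Coherent orientation: after reversing some faces, the two sides along each edge traverse
  it in opposite directions.\<close>

definition orientable :: "'v set set \<Rightarrow> 'v list list \<Rightarrow> bool" where
  "orientable E fs \<longleftrightarrow>
     (\<exists>gs. list_all2 (\<lambda>f g. g = f \<or> g = rev f) fs gs \<and>
       (\<forall>u v. {u, v} \<in> E \<longrightarrow> count_list (concat (map sides gs)) (u, v) = 1))"


section \<open>Domes\<close>

definition abstract_complex :: "nat set set \<Rightarrow> bool" where
  "abstract_complex K \<longleftrightarrow> finite K \<and>
     (\<forall>\<sigma>\<in>K. \<sigma> \<noteq> {} \<and> finite \<sigma> \<and> (\<forall>\<tau>. \<tau> \<subseteq> \<sigma> \<and> \<tau> \<noteq> {} \<longrightarrow> \<tau> \<in> K))"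

definition simplices :: "nat \<Rightarrow> nat set set \<Rightarrow> nat set set" where
  "simplices d K = {\<sigma> \<in> K. card \<sigma> = Suc d}"

text \<open>An orientable dome over the curves \<open>\<Gamma>\<close> is an abstract complex \<open>K\<close> of dimension at most two
  with a map \<open>\<phi>\<close> of its vertices, extended affinely to simplices: unit edges make all triangles
  unit equilateral. The list \<open>ts\<close> enumerates the triangles of \<open>K\<close>, each once, with an arbitrary
  order of its vertices, and \<open>ws\<close> consists of the closed walks in \<open>K\<close>, mapped by \<open>\<phi>\<close> to the
  curves in \<open>\<Gamma>\<close>, along which the closing disks are attached. An edge of \<open>K\<close> may lie in no
  triangle, namely if both of its sides belong to closing disks.\<close>

definition orientable_dome :: "(real^3) list list \<Rightarrow> nat set set \<Rightarrow> (nat \<Rightarrow> real^3) \<Rightarrow> bool" where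
  "orientable_dome \<Gamma> K \<phi> \<longleftrightarrow>
     abstract_complex K \<and>
     (\<forall>\<sigma>\<in>K. card \<sigma> \<le> 3) \<and>
     (\<forall>u v. {u, v} \<in> simplices 1 K \<longrightarrow> dist (\<phi> u) (\<phi> v) = 1) \<and>
     (\<exists>ts ws.
        (\<forall>t\<in>set ts. length t = 3) \<and>
        distinct (map set ts) \<and> set ` set ts = simplices 2 K \<and>
        map (map \<phi>) ws = \<Gamma> \<and>
        closed_surface (\<Union>K) (simplices 1 K) (ts @ ws) \<and>
        orientable (simplices 1 K) (ts @ ws))"

definition orientably_cobordant :: "(real^3) list \<Rightarrow> (real^3) list \<Rightarrow> bool" where
  "orientably_cobordant \<gamma> \<eta> \<longleftrightarrow> (\<exists>K \<phi>. orientable_dome [\<gamma>, \<eta>] K \<phi>)"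

end

theory Submission
  imports Defs "HOL-Computational_Algebra.Polynomial"
begin

text \<open>The moduli space of closed \<open>n\<close>-gons with unit edges carries the symplectic form
  \<open>\<omega> = \<Sum>det(e, \<delta>e, \<delta>'e)\<close>, the sum being over the edge vectors \<open>e\<close>. The summand is odd in \<open>e\<close>,
  so in an orientable dome the contributions of each edge from its two sides cancel, and it sums
  to zero over a unit triangle because triangles are rigid. Hence \<open>\<omega>\<close> agrees up to sign on
  the two ends of an orientable cobordism. A rhombus has only two moduli, so the Pfaffian of \<open>\<omega>\<close> on
  four tangent vectors vanishes there, whereas \<open>\<omega>\<close> is nondegenerate on the four-dimensional
  space of pentagons. Since a dome is a single configuration and not a family, derivations of the
  field \<open>\<real>\<close> applied to all coordinates play the role of tangent vectors; a pentagon with four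
  algebraically independent parameters admits four independent derivations.\<close>


section \<open>Derivations of fields\<close>

definition subring_of :: "'a::comm_ring_1 set \<Rightarrow> bool" where
  "subring_of A \<longleftrightarrow> 1 \<in> A \<and> (\<forall>a\<in>A. \<forall>b\<in>A. a + b \<in> A \<and> a * b \<in> A) \<and> (\<forall>a\<in>A. - a \<in> A)"

lemma subring_ofD:
  assumes "subring_of A"
  shows "1 \<in> A" "0 \<in> A" "a \<in> A \<Longrightarrow> b \<in> A \<Longrightarrow> a + b \<in> A" "a \<in> A \<Longrightarrow> b \<in> A \<Longrightarrow> a * b \<in> A"
    "a \<in> A \<Longrightarrow> - a \<in> A" "a \<in> A \<Longrightarrow> b \<in> A \<Longrightarrow> a - b \<in> A"
proof -
  show one: "1 \<in> A" and add: "a \<in> A \<Longrightarrow> b \<in> A \<Longrightarrow> a + b \<in> A"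
    and "a \<in> A \<Longrightarrow> b \<in> A \<Longrightarrow> a * b \<in> A" and minus: "a \<in> A \<Longrightarrow> - a \<in> A" for a b
    using assms by (auto simp: subring_of_def)
  show "0 \<in> A" using add[OF one minus[OF one]] by simp
  show "a \<in> A \<Longrightarrow> b \<in> A \<Longrightarrow> a - b \<in> A" using add[of a "- b"] minus[of b] by simp
qed

lemma subring_of_sum:
  assumes "subring_of A" "\<And>i. i \<in> I \<Longrightarrow> f i \<in> A"
  shows "sum f I \<in> A"
  using assms(2) by (induction I rule: infinite_finite_induct) (auto simp: subring_ofD[OF assms(1)])

lemma subring_of_of_nat: "subring_of A \<Longrightarrow> of_nat n \<in> A"
  by (induction n) (auto simp: subring_ofD)

definition polys_over :: "'a::comm_ring_1 set \<Rightarrow> 'a poly set" where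
  "polys_over A = {p. \<forall>i. coeff p i \<in> A}"

lemma subring_of_polys_over:
  assumes A: "subring_of A" shows "subring_of (polys_over A)"
  unfolding subring_of_def[of "polys_over A"]
  by (auto simp: polys_over_def coeff_mult coeff_1 subring_ofD[OF A] intro!: subring_of_sum[OF A])

lemma polys_over_simps:
  assumes A: "subring_of A"
  shows "a \<in> A \<Longrightarrow> [:a:] \<in> polys_over A" "[:0, 1:] \<in> polys_over A"
    "a \<in> A \<Longrightarrow> monom a n \<in> polys_over A" "a \<in> A \<Longrightarrow> p \<in> polys_over A \<Longrightarrow> smult a p \<in> polys_over A"
  by (auto simp: polys_over_def coeff_pCons subring_ofD[OF A] split: nat.split)

lemma pderiv_polys_over:
  fixes A :: "'a::idom set"
  assumes A: "subring_of A" shows "p \<in> polys_over A \<Longrightarrow> pderiv p \<in> polys_over A"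
  by (auto simp: polys_over_def coeff_pderiv intro!: subring_ofD(4)[OF A] subring_of_of_nat[OF A]
      simp del: of_nat_Suc)

definition transcendental_over :: "'a::comm_ring_1 set \<Rightarrow> 'a \<Rightarrow> bool" where
  "transcendental_over A x \<longleftrightarrow> (\<forall>p\<in>polys_over A. poly p x = 0 \<longrightarrow> p = 0)"

definition adjoin :: "'a::comm_ring_1 set \<Rightarrow> 'a \<Rightarrow> 'a set" where
  "adjoin A x = (\<lambda>p. poly p x) ` polys_over A"

lemma subring_of_adjoin:
  assumes A: "subring_of A" shows "subring_of (adjoin A x)"
proof -
  note P = subring_ofD[OF subring_of_polys_over[OF A]]
  show ?thesis
    unfolding subring_of_def adjoin_def
  proof (intro conjI ballI; (elim imageE)?; hypsubst?)
    show "1 \<in> (\<lambda>p. poly p x) ` polys_over A"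
      using P(1) by (metis image_eqI poly_1)
  next
    fix p q assume "p \<in> polys_over A" "q \<in> polys_over A"
    then show "poly p x + poly q x \<in> (\<lambda>p. poly p x) ` polys_over A"
      and "poly p x * poly q x \<in> (\<lambda>p. poly p x) ` polys_over A"
      by (metis P(3) image_eqI poly_add, metis P(4) image_eqI poly_mult)
  next
    fix p assume "p \<in> polys_over A"
    then show "- poly p x \<in> (\<lambda>p. poly p x) ` polys_over A"
      by (metis P(5) image_eqI poly_minus)
  qed
qed

lemma adjoin_supset:
  assumes A: "subring_of A" shows "A \<subseteq> adjoin A x" "x \<in> adjoin A x"
proof -
  show "A \<subseteq> adjoin A x"
  proof
    fix a assume "a \<in> A"
    then show "a \<in> adjoin A x"
      using polys_over_simps(1)[OF A] by (force simp: adjoin_def image_iff)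
  qed
  show "x \<in> adjoin A x"
    using polys_over_simps(2)[OF A] by (auto simp: adjoin_def image_iff intro!: bexI[of _ "[:0,1:]"])
qed

lemma countable_polys_over:
  assumes "countable A" shows "countable (polys_over A)"
proof -
  have "polys_over A \<subseteq> Poly ` lists A"
  proof
    fix p assume "p \<in> polys_over A"
    then have "coeffs p \<in> lists A"
      by (auto simp: polys_over_def coeffs_def)
    then show "p \<in> Poly ` lists A" by (metis Poly_coeffs image_eqI)
  qed
  moreover have "countable (Poly ` lists A)" using assms by simp
  ultimately show ?thesis by (rule countable_subset)
qed

lemma countable_adjoin: "countable A \<Longrightarrow> countable (adjoin A x)"
  by (simp add: adjoin_def countable_polys_over)

text \<open>There are only countably many nonzero polynomials over a countable \<open>A\<close>,
  each with finitely many roots, while the interval is uncountable.\<close>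

lemma transcendental_over_exists:
  fixes A :: "real set"
  assumes "countable A" "l < r"
  shows "\<exists>x. l < x \<and> x < r \<and> transcendental_over A x"
proof -
  let ?R = "\<Union>p\<in>polys_over A - {0}. {x. poly p x = 0}"
  have "countable ?R"
    using countable_polys_over[OF assms(1)]
    by (intro countable_UN) (auto intro: countable_finite poly_roots_finite)
  then have "\<not> {l<..<r} \<subseteq> ?R"
    using uncountable_open_interval[of l r] assms(2) countable_subset by blast
  then show ?thesis by (auto simp: transcendental_over_def)
qed

section \<open>Derivations and their extension by one element\<close>

text \<open>Only the arguments are confined to \<open>A\<close>; values may lie anywhere in the
  ambient ring. This leaves room for the quotient that arises when an algebraic element is
  adjoined.\<close>

definition derivation_on :: "'a::comm_ring_1 set \<Rightarrow> ('a \<Rightarrow> 'a) \<Rightarrow> bool" where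
  "derivation_on A D \<longleftrightarrow> (\<forall>a\<in>A. \<forall>b\<in>A. D (a + b) = D a + D b \<and> D (a * b) = a * D b + D a * b)"

lemma derivation_onD:
  assumes D: "derivation_on A D" and A: "subring_of A"
  shows "a \<in> A \<Longrightarrow> b \<in> A \<Longrightarrow> D (a + b) = D a + D b"
    "a \<in> A \<Longrightarrow> b \<in> A \<Longrightarrow> D (a * b) = a * D b + D a * b"
    "D 0 = 0" "D 1 = 0" "a \<in> A \<Longrightarrow> D (- a) = - D a"
    "a \<in> A \<Longrightarrow> b \<in> A \<Longrightarrow> D (a - b) = D a - D b"
proof -
  show add: "D (a + b) = D a + D b" and mult: "D (a * b) = a * D b + D a * b" if "a \<in> A" "b \<in> A" for a b
    using D that by (auto simp: derivation_on_def)
  show zero: "D 0 = 0" using add[of 0 0] subring_ofD(2)[OF A] by simp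
  show "D 1 = 0" using mult[of 1 1] subring_ofD(1)[OF A] by simp
  show minus: "D (- a) = - D a" if "a \<in> A" for a
    using add[OF that subring_ofD(5)[OF A that]] zero by (simp add: eq_neg_iff_add_eq_0 add.commute)
  show "a \<in> A \<Longrightarrow> b \<in> A \<Longrightarrow> D (a - b) = D a - D b"
    using add[of a "- b"] minus[of b] subring_ofD(5)[OF A, of b] by simp
qed

lemma derivation_on_sum:
  assumes D: "derivation_on A D" and A: "subring_of A" and "\<And>i. i \<in> I \<Longrightarrow> f i \<in> A"
  shows "D (sum f I) = (\<Sum>i\<in>I. D (f i))"
  using assms(3)
  by (induction I rule: infinite_finite_induct)
     (auto simp: derivation_onD[OF D A] subring_of_sum[OF A])

text \<open>The value at \<open>p(x)\<close> of an extension of \<open>D\<close> that maps \<open>x\<close> to \<open>c\<close>.\<close>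

definition ext_deriv :: "('a::idom \<Rightarrow> 'a) \<Rightarrow> 'a \<Rightarrow> 'a \<Rightarrow> 'a poly \<Rightarrow> 'a" where
  "ext_deriv D x c p = poly (map_poly D p) x + c * poly (pderiv p) x"

context
  fixes A :: "'a::idom set" and D
  assumes A: "subring_of A" and D: "derivation_on A D"
begin

lemma map_poly_derivation:
  assumes "p \<in> polys_over A" "q \<in> polys_over A"
  shows "map_poly D (p + q) = map_poly D p + map_poly D q"
    and "map_poly D (p * q) = p * map_poly D q + map_poly D p * q"
  using assms
  by (intro poly_eqI; auto simp: coeff_map_poly derivation_onD[OF D A] polys_over_def coeff_mult
      derivation_on_sum[OF D A] subring_ofD[OF A] sum.distrib)+

lemma ext_deriv_simps:
  assumes "p \<in> polys_over A" "q \<in> polys_over A"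
  shows "ext_deriv D x c (p + q) = ext_deriv D x c p + ext_deriv D x c q"
    and "ext_deriv D x c (p * q) = poly p x * ext_deriv D x c q + ext_deriv D x c p * poly q x"
  by (simp_all add: ext_deriv_def map_poly_derivation[OF assms] pderiv_add pderiv_mult algebra_simps)

lemma ext_deriv_const: "ext_deriv D x c [:a:] = D a"
  by (simp add: ext_deriv_def map_poly_pCons derivation_onD[OF D A])

lemma ext_deriv_var: "ext_deriv D x c [:0, 1:] = c"
  by (simp add: ext_deriv_def map_poly_pCons derivation_onD[OF D A] pderiv_pCons)

text \<open>Two polynomials representing the same element differ by one that vanishes at
  \<open>x\<close>. The assumption applied to this difference makes the extension well defined, and
  the sum and product rules carry over from polynomials.\<close>

lemma derivation_on_adjoin:
  assumes c: "\<And>p. p \<in> polys_over A \<Longrightarrow> poly p x = 0 \<Longrightarrow> ext_deriv D x c p = 0"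
  shows "\<exists>D'. derivation_on (adjoin A x) D' \<and> (\<forall>a\<in>A. D' a = D a) \<and> D' x = c"
proof -
  note P = subring_ofD[OF subring_of_polys_over[OF A]]
  define D' where "D' y = ext_deriv D x c (SOME p. p \<in> polys_over A \<and> poly p x = y)" for y
  have D': "D' (poly p x) = ext_deriv D x c p" if p: "p \<in> polys_over A" for p
  proof -
    define q where "q = (SOME q. q \<in> polys_over A \<and> poly q x = poly p x)"
    have q: "q \<in> polys_over A" "poly q x = poly p x"
      using someI[of "\<lambda>q. q \<in> polys_over A \<and> poly q x = poly p x" p] p by (auto simp: q_def)
    have "ext_deriv D x c (q - p) = 0"
      using q p by (intro c) (auto simp: P)
    moreover have "ext_deriv D x c q = ext_deriv D x c (q - p) + ext_deriv D x c p"
      using ext_deriv_simps(1)[of "q - p" p x c] q p by (simp add: P)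
    ultimately show ?thesis by (simp add: D'_def q_def)
  qed
  have "derivation_on (adjoin A x) D'"
    unfolding derivation_on_def adjoin_def
  proof (intro ballI; elim imageE; hypsubst)
    fix p q assume pq: "p \<in> polys_over A" "q \<in> polys_over A"
    show "D' (poly p x + poly q x) = D' (poly p x) + D' (poly q x) \<and>
        D' (poly p x * poly q x) = poly p x * D' (poly q x) + D' (poly p x) * poly q x"
      using D'[of "p + q"] D'[of "p * q"] pq by (simp add: D' ext_deriv_simps P)
  qed
  moreover have "D' a = D a" if "a \<in> A" for a
    using D'[of "[:a:]"] polys_over_simps(1)[OF A that] by (simp add: ext_deriv_const)
  moreover have "D' x = c"
    using D'[of "[:0, 1:]"] polys_over_simps(2)[OF A] by (simp add: ext_deriv_var)
  ultimately show ?thesis by blast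
qed

end

lemma ext_deriv_0 [simp]: "ext_deriv D x c 0 = 0"
  by (simp add: ext_deriv_def)

text \<open>For algebraic \<open>x\<close> the value \<open>c\<close> is forced by an annihilating polynomial \<open>m\<close> of minimal degree.
  As \<open>A\<close> is only a ring, other annihilating polynomials are reduced to \<open>m\<close> by pseudo-division.\<close>

lemma ext_deriv_vanishing_exists:
  fixes A :: "'a::field_char_0 set"
  assumes A: "subring_of A" and D: "derivation_on A D"
  shows "\<exists>c. \<forall>p\<in>polys_over A. poly p x = 0 \<longrightarrow> ext_deriv D x c p = 0"
proof (cases "transcendental_over A x")
  case True
  then show ?thesis by (metis transcendental_over_def ext_deriv_0)
next
  case False
  note P = subring_ofD[OF subring_of_polys_over[OF A]]
  define Q where "Q p \<longleftrightarrow> p \<in> polys_over A \<and> poly p x = 0" for p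
  obtain m where m: "Q m" "m \<noteq> 0" and min: "\<And>p. Q p \<Longrightarrow> p \<noteq> 0 \<Longrightarrow> degree m \<le> degree p"
  proof -
    obtain p where "Q p \<and> p \<noteq> 0" using False by (auto simp: transcendental_over_def Q_def)
    from ex_has_least_nat[of "\<lambda>p. Q p \<and> p \<noteq> 0", OF this, of degree] show thesis
      using that by blast
  qed
  have "degree m \<noteq> 0"
  proof
    assume "degree m = 0"
    then obtain a where "m = [:a:]" by (rule degree_eq_zeroE)
    then show False using m by (simp add: Q_def)
  qed
  \<comment> \<open>Characteristic zero enters here: the derivative of the nonconstant
    \<open>m\<close> is nonzero and of smaller degree, so by minimality it does not vanish at
    \<open>x\<close>.\<close>
  then have "pderiv m \<noteq> 0" "degree (pderiv m) < degree m"
    by (auto simp: pderiv_eq_0_iff degree_pderiv)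
  then have m': "poly (pderiv m) x \<noteq> 0"
    using min[of "pderiv m"] pderiv_polys_over[OF A] m by (auto simp: Q_def)
  \<comment> \<open>The unique solution of \<open>ext_deriv D x c m = 0\<close>.\<close>
  define c where "c = - poly (map_poly D m) x / poly (pderiv m) x"
  have cm: "ext_deriv D x c m = 0"
    using m' by (simp add: ext_deriv_def c_def)
  have "ext_deriv D x c p = 0" if "Q p" for p
    using that
  proof (induction "degree p" arbitrary: p rule: less_induct)
    case less
    show ?case
    proof (cases "p = 0")
      case True
      then show ?thesis by (simp add: ext_deriv_def)
    next
      case False
      define k where "k = degree p - degree m"
      have deg: "degree p = degree m + k" using min[OF less.prems False] by (simp add: k_def)
      define a where "a = [:lead_coeff m:]"
      define b where "b = monom (lead_coeff p) k"
      define r where "r = a * p - b * m"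
      have a: "a \<in> polys_over A" and b: "b \<in> polys_over A" and pm: "p \<in> polys_over A" "m \<in> polys_over A"
        using m less.prems polys_over_simps[OF A] by (auto simp: a_def b_def Q_def polys_over_def)
      have Qr: "Q r" using a b pm m less.prems by (auto simp: Q_def r_def P)
      have "ext_deriv D x c r = 0"
      proof (cases "r = 0")
        case True
        then show ?thesis by (simp add: ext_deriv_def)
      next
        case False
        have "degree r \<le> degree p"
          unfolding r_def a_def b_def
        proof (rule degree_diff_le)
          show "degree ([:lead_coeff m:] * p) \<le> degree p" by simp
          have "degree (monom (lead_coeff p) k * m) \<le> degree (monom (lead_coeff p) k) + degree m"
            by (rule degree_mult_le)
          also have "\<dots> \<le> degree p" by (simp add: deg degree_monom_le)
          finally show "degree (monom (lead_coeff p) k * m) \<le> degree p" .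
        qed
        moreover have "coeff r (degree p) = 0"
          by (simp add: r_def a_def b_def deg coeff_monom_mult add.commute[of k])
        ultimately have "degree r < degree p"
          using False by (metis le_neq_implies_less leading_coeff_0_iff)
        then show ?thesis using less.hyps Qr by blast
      qed
      moreover have "a * p = r + b * m" by (simp add: r_def)
      then have "ext_deriv D x c (a * p) = ext_deriv D x c r + ext_deriv D x c (b * m)"
        using ext_deriv_simps(1)[OF A D, of r "b * m" x c] Qr b pm by (simp add: Q_def P)
      ultimately have "ext_deriv D x c (a * p) = 0"
        using cm m b pm by (simp add: ext_deriv_simps[OF A D] Q_def)
      \<comment> \<open>In the product rule for \<open>a * p\<close> the other term contains the
        factor \<open>poly p x\<close>, which is zero.\<close>
      then have "lead_coeff m * ext_deriv D x c p = 0"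
        using a pm less.prems by (simp add: ext_deriv_simps[OF A D] Q_def) (simp add: a_def)
      then show ?thesis using m by simp
    qed
  qed
  then show ?thesis unfolding Q_def by blast
qed

section \<open>Extension to the whole field by Zorn's lemma\<close>

text \<open>Passing to graphs forgets the values outside the domain, so that extension of partial
  derivations becomes set inclusion.\<close>

definition derivation_graphs :: "'a::comm_ring_1 set \<Rightarrow> ('a \<Rightarrow> 'a) \<Rightarrow> ('a \<times> 'a) set set" where
  "derivation_graphs A D = {(\<lambda>b. (b, D' b)) ` B | B D'.
     subring_of B \<and> derivation_on B D' \<and> A \<subseteq> B \<and> (\<forall>a\<in>A. D' a = D a)}"

text \<open>Members of a chain are comparable, so they agree on common arguments, and any two
  elements of the union of the domains lie in a single domain, where the ring and derivation laws
  hold.\<close>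

lemma Union_chain_derivation_graphs:
  assumes ne: "\<C> \<noteq> {}" and chain: "subset.chain (derivation_graphs A D) \<C>"
  shows "\<Union>\<C> \<in> derivation_graphs A D"
proof -
  define D' where "D' a = (THE y. (a, y) \<in> \<Union>\<C>)" for a
  have ex: "\<exists>B. G = (\<lambda>b. (b, D' b)) ` B \<and> subring_of B \<and> derivation_on B D' \<and> A \<subseteq> B \<and> (\<forall>a\<in>A. D' a = D a)"
    if G: "G \<in> \<C>" for G
  proof -
    obtain B E where B: "G = (\<lambda>b. (b, E b)) ` B" "subring_of B" "derivation_on B E" "A \<subseteq> B" "\<forall>a\<in>A. E a = D a"
      using G chain by (auto simp: subset.chain_def derivation_graphs_def)
    have E: "D' b = E b" if b: "b \<in> B" for b
      unfolding D'_def
    proof (rule the_equality)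
      show "(b, E b) \<in> \<Union>\<C>" using b B G by blast
    next
      fix y assume "(b, y) \<in> \<Union>\<C>"
      then obtain H where H: "H \<in> \<C>" "(b, y) \<in> H" by blast
      have "H \<in> derivation_graphs A D" using H chain by (auto simp: subset.chain_def)
      then obtain B' E' where H': "H = (\<lambda>b. (b, E' b)) ` B'" by (auto simp: derivation_graphs_def)
      have "G \<subseteq> H \<or> H \<subseteq> G" using chain G H by (auto simp: subset.chain_def)
      \<comment> \<open>Whichever graph contains the other, the larger one is single-valued at
        \<open>b\<close>.\<close>
      then show "y = E b" using H' H(2) B(1) b by auto
    qed
    have "derivation_on B D'"
      using B(3) E subring_ofD[OF B(2)] by (simp add: derivation_on_def)
    then show ?thesis using B E by (intro exI[of _ B]) auto
  qed
  define B where "B = fst ` \<Union>\<C>"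
  have "\<Union>\<C> = (\<lambda>b. (b, D' b)) ` B"
  proof (intro equalityI subsetI)
    fix z assume z: "z \<in> \<Union>\<C>"
    then obtain b where "z = (b, D' b)" using ex by blast
    with z show "z \<in> (\<lambda>b. (b, D' b)) ` B" by (force simp: B_def)
  next
    fix z assume "z \<in> (\<lambda>b. (b, D' b)) ` B"
    then obtain b y G where "z = (b, D' b)" "(b, y) \<in> G" "G \<in> \<C>" by (auto simp: B_def)
    moreover from this have "y = D' b" using ex by blast
    ultimately show "z \<in> \<Union>\<C>" by blast
  qed
  moreover have closed: "\<exists>B'\<subseteq>B. a \<in> B' \<and> b \<in> B' \<and> subring_of B' \<and> derivation_on B' D'" if ab: "a \<in> B" "b \<in> B" for a b
  proof -
    obtain G H where GH: "G \<in> \<C>" "a \<in> fst ` G" "H \<in> \<C>" "b \<in> fst ` H"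
      using ab by (auto simp: B_def)
    then have "G \<subseteq> H \<or> H \<subseteq> G" using chain by (auto simp: subset.chain_def)
    then obtain F where F: "F \<in> \<C>" "a \<in> fst ` F" "b \<in> fst ` F" using GH by blast
    obtain B' where B': "F = (\<lambda>b. (b, D' b)) ` B'" "subring_of B'" "derivation_on B' D'"
      using ex[OF F(1)] by blast
    have "B' = fst ` F" by (simp add: B' image_image)
    moreover from this have "B' \<subseteq> B" using F(1) unfolding B_def by blast
    ultimately show ?thesis using F B' by blast
  qed
  obtain G where "G \<in> \<C>" using ne by blast
  then obtain B1 where B1: "G = (\<lambda>b. (b, D' b)) ` B1" "subring_of B1" "A \<subseteq> B1" "\<forall>a\<in>A. D' a = D a"
    using ex by blast
  have B1B: "B1 \<subseteq> B" using B1(1) \<open>G \<in> \<C>\<close> by (force simp: B_def)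
  have "a + b \<in> B \<and> a * b \<in> B \<and> - a \<in> B" if ab: "a \<in> B" "b \<in> B" for a b
  proof -
    obtain B' where B': "B' \<subseteq> B" "a \<in> B'" "b \<in> B'" "subring_of B'" using closed[OF ab] by blast
    have "a + b \<in> B' \<and> a * b \<in> B' \<and> - a \<in> B'" using B' by (simp add: subring_ofD)
    then show ?thesis using B'(1) by blast
  qed
  then have "subring_of B"
    using B1B subring_ofD(1)[OF B1(2)] by (auto simp: subring_of_def)
  moreover have "derivation_on B D'"
    unfolding derivation_on_def
  proof (intro ballI)
    fix a b assume "a \<in> B" "b \<in> B"
    then obtain B' where B': "a \<in> B'" "b \<in> B'" "derivation_on B' D'" using closed by blast
    then show "D' (a + b) = D' a + D' b \<and> D' (a * b) = a * D' b + D' a * b"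
      by (simp add: derivation_on_def)
  qed
  ultimately show ?thesis
    using B1(3,4) B1B unfolding derivation_graphs_def
    by (intro CollectI exI[of _ B] exI[of _ D'] conjI) auto
qed

text \<open>A maximal extension is defined everywhere, since any missing element could be adjoined
  to its domain.\<close>

theorem derivation_extends:
  fixes A :: "'a::field_char_0 set"
  assumes A: "subring_of A" and D: "derivation_on A D"
  shows "\<exists>D'. derivation_on UNIV D' \<and> (\<forall>a\<in>A. D' a = D a)"
proof -
  have "(\<lambda>b. (b, D b)) ` A \<in> derivation_graphs A D"
    using A D unfolding derivation_graphs_def
    by (intro CollectI exI[of _ A] exI[of _ D] conjI) auto
  then have "derivation_graphs A D \<noteq> {}" by blast
  from subset_Zorn_nonempty[OF this Union_chain_derivation_graphs]
  obtain M where M: "M \<in> derivation_graphs A D"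
    and max: "\<And>X. X \<in> derivation_graphs A D \<Longrightarrow> M \<subseteq> X \<Longrightarrow> X = M" by blast
  obtain B E where B: "M = (\<lambda>b. (b, E b)) ` B" "subring_of B" "derivation_on B E" "A \<subseteq> B" "\<forall>a\<in>A. E a = D a"
    using M by (auto simp: derivation_graphs_def)
  have "x \<in> B" for x
  proof -
    obtain c where "\<forall>p\<in>polys_over B. poly p x = 0 \<longrightarrow> ext_deriv E x c p = 0"
      using ext_deriv_vanishing_exists[OF B(2,3)] by blast
    then obtain E' where E': "derivation_on (adjoin B x) E'" "\<forall>a\<in>B. E' a = E a"
      using derivation_on_adjoin[OF B(2,3), of x c] by blast
    let ?X = "(\<lambda>b. (b, E' b)) ` adjoin B x"
    have "?X \<in> derivation_graphs A D"
      using E' B(4,5) adjoin_supset(1)[OF B(2), of x] subring_of_adjoin[OF B(2), of x]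
      unfolding derivation_graphs_def
      by (intro CollectI exI[of _ "adjoin B x"] exI[of _ E'] conjI) auto
    moreover have "M \<subseteq> ?X"
      using E'(2) adjoin_supset(1)[OF B(2), of x] by (force simp: B(1))
    ultimately have "?X = M" by (rule max)
    then have "fst ` ?X = fst ` M" by simp
    then show "x \<in> B" using adjoin_supset(2)[OF B(2), of x] by (simp add: B(1) image_image)
  qed
  then have "B = UNIV" by blast
  then show ?thesis using B by blast
qed

text \<open>Only the zero polynomial annihilates \<open>x\<close>, so the zero derivation on
  \<open>A\<close> can be extended with any prescribed value at \<open>x\<close>, here 1.\<close>

corollary derivation_transcendental:
  fixes A :: "'a::field_char_0 set"
  assumes A: "subring_of A" and x: "transcendental_over A x"
  shows "\<exists>D. derivation_on UNIV D \<and> (\<forall>a\<in>A. D a = 0) \<and> D x = 1"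
proof -
  have D: "derivation_on A (\<lambda>_. 0)" by (simp add: derivation_on_def)
  obtain E where E: "derivation_on (adjoin A x) E" "\<forall>a\<in>A. E a = 0" "E x = 1"
    using derivation_on_adjoin[OF A D, of x 1] x
    by (metis transcendental_over_def ext_deriv_0)
  then show ?thesis
    using derivation_extends[OF subring_of_adjoin[OF A, of x] E(1)] adjoin_supset[OF A, of x]
    by (metis subsetD)
qed


section \<open>The symplectic form on closed curves\<close>

definition dvec :: "(real \<Rightarrow> real) \<Rightarrow> real^3 \<Rightarrow> real^3" where
  "dvec D x = (\<chi> i. D (x $ i))"

definition triple :: "real^3 \<Rightarrow> real^3 \<Rightarrow> real^3 \<Rightarrow> real" where
  "triple x y z = x \<bullet> cross3 y z"

text \<open>A product of two determinants is the determinant of the matrix of mutual inner products.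
  Multiplying by a suitable triple product thus reduces later identities to relations between inner
  products.\<close>

lemma triple_mult_triple:
  "triple x y z * triple u v w =
     (x \<bullet> u) * ((y \<bullet> v) * (z \<bullet> w) - (y \<bullet> w) * (z \<bullet> v))
   - (x \<bullet> v) * ((y \<bullet> u) * (z \<bullet> w) - (y \<bullet> w) * (z \<bullet> u))
   + (x \<bullet> w) * ((y \<bullet> u) * (z \<bullet> v) - (y \<bullet> v) * (z \<bullet> u))"
  unfolding triple_def inner_vec_def sum_3 cross3_def inner_real_def vector_3
  by algebra

text \<open>A unit triangle is rigid, so the two variations are infinitesimal rotations with axes a
  and b, say. On a unit edge e the summand is then the inner product of e with the cross product of
  a and b, which is linear in e.\<close>

lemma triple_sum_triangle:
  fixes u v U V U' V' :: "real^3"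
  assumes "u \<bullet> u = 1" "v \<bullet> v = 1" "(u + v) \<bullet> (u + v) = 1"
   "U \<bullet> u = 0" "V \<bullet> v = 0" "(U + V) \<bullet> (u + v) = 0"
   "U' \<bullet> u = 0" "V' \<bullet> v = 0" "(U' + V') \<bullet> (u + v) = 0"
 shows "triple u U U' + triple v V V' = triple (u + v) (U + V) (U' + V')"
proof -
  define n where "n = cross3 u v"
  have n: "u \<bullet> n = 0" "v \<bullet> n = 0" by (simp_all add: n_def dot_cross_self)
  have c: "v \<bullet> u = u \<bullet> v" by (rule inner_commute)
  have uv: "u \<bullet> v = - 1/2" using assms(1-3) by (simp add: inner_add c)
  have d: "V \<bullet> u = - (U \<bullet> v)" "V' \<bullet> u = - (U' \<bullet> v)" using assms(4-) by (auto simp: inner_add)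
  have "triple u v n = n \<bullet> n" by (simp add: triple_def n_def cross_triple[of u] inner_commute)
  also have "n \<bullet> n = 3/4"
    using assms(1,2) uv by (simp add: n_def dot_cross c)
  finally have nn: "triple u v n \<noteq> 0" by simp
  \<comment> \<open>The nonzero factor \<open>triple u v n\<close> turns the claim into an identity
    between inner products.\<close>
  have "(triple u U U' + triple v V V' - triple (u + v) (U + V) (U' + V')) * triple u v n = 0"
    unfolding left_diff_distrib distrib_right triple_mult_triple inner_add_left c n uv d assms(1,2,4,5,7,8)
    by algebra
  then show ?thesis using nn by simp
qed

text \<open>The edges are \<open>u\<close>, \<open>v\<close>, \<open>w\<close> and
  \<open>- (u + v + w)\<close>. The right-hand side is the wedge product of the differentials of
  \<open>u \<bullet> v\<close> and \<open>u \<bullet> w\<close>, evaluated on the two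
  variations.\<close>

lemma triple_sum_rhombus:
  fixes u v w U V W U' V' W' :: "real^3"
  assumes "u \<bullet> u = 1" "v \<bullet> v = 1" "w \<bullet> w = 1" "(u + v + w) \<bullet> (u + v + w) = 1"
   "U \<bullet> u = 0" "V \<bullet> v = 0" "W \<bullet> w = 0" "(U + V + W) \<bullet> (u + v + w) = 0"
   "U' \<bullet> u = 0" "V' \<bullet> v = 0" "W' \<bullet> w = 0" "(U' + V' + W') \<bullet> (u + v + w) = 0"
 shows "triple u v w * (triple u U U' + triple v V V' + triple w W W'
    - triple (u + v + w) (U + V + W) (U' + V' + W'))
   = (U \<bullet> v + V \<bullet> u) * (U' \<bullet> w + W' \<bullet> u) - (U' \<bullet> v + V' \<bullet> u) * (U \<bullet> w + W \<bullet> u)"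
proof -
  \<comment> \<open>The unit length of the fourth edge eliminates \<open>v \<bullet> w\<close>,
    \<open>V \<bullet> w\<close> and \<open>V' \<bullet> w\<close>.\<close>
  have d: "v \<bullet> w = -1 - u \<bullet> v - u \<bullet> w"
    "V \<bullet> w = - (U \<bullet> v) - V \<bullet> u - U \<bullet> w - W \<bullet> u - W \<bullet> v"
    "V' \<bullet> w = - (U' \<bullet> v) - V' \<bullet> u - U' \<bullet> w - W' \<bullet> u - W' \<bullet> v"
    using assms by (simp_all add: inner_add inner_commute)
  have c: "v \<bullet> u = u \<bullet> v" "w \<bullet> u = u \<bullet> w" "w \<bullet> v = v \<bullet> w" by (simp_all add: inner_commute)
  show ?thesis
    unfolding mult.commute[of "triple u v w"] left_diff_distrib distrib_right triple_mult_triple inner_add_left c assms(1-3,5-7,9-11) d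
    by algebra
qed

lemma derivation_UNIV:
  fixes D :: "'a::comm_ring_1 \<Rightarrow> 'a"
  assumes "derivation_on UNIV D"
  shows "D (a + b) = D a + D b" "D (a * b) = a * D b + D a * b" "D 0 = 0" "D 1 = 0"
    "D (- a) = - D a" "D (a - b) = D a - D b"
proof -
  have A: "subring_of (UNIV :: 'a set)" by (simp add: subring_of_def)
  note * = derivation_onD[OF assms A]
  show "D (a + b) = D a + D b" "D (a * b) = a * D b + D a * b" "D 0 = 0" "D 1 = 0"
    "D (- a) = - D a" "D (a - b) = D a - D b"
    by (simp_all add: *)
qed

context
  fixes D :: "real \<Rightarrow> real" assumes D: "derivation_on UNIV D"
begin

lemma dvec_simps: "dvec D (x + y) = dvec D x + dvec D y" "dvec D (- x) = - dvec D x"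
    "dvec D (x - y) = dvec D x - dvec D y"
  by (simp_all add: dvec_def vec_eq_iff derivation_UNIV[OF D])

lemma derivation_inner: "D (x \<bullet> y) = x \<bullet> dvec D y + dvec D x \<bullet> y"
  by (simp add: inner_vec_def sum_3 dvec_def derivation_UNIV[OF D])

lemma dvec_orthogonal: "x \<bullet> x = 1 \<Longrightarrow> dvec D x \<bullet> x = 0"
  using derivation_inner[of x x] by (simp add: derivation_UNIV[OF D] inner_commute)

end

definition edge_form :: "(real \<Rightarrow> real) \<Rightarrow> (real \<Rightarrow> real) \<Rightarrow> real^3 \<Rightarrow> real" where
  "edge_form D D' e = triple e (dvec D e) (dvec D' e)"

definition curve_form :: "(real \<Rightarrow> real) \<Rightarrow> (real \<Rightarrow> real) \<Rightarrow> (real^3) list \<Rightarrow> real" where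
  "curve_form D D' vs = (\<Sum>(p, q)\<leftarrow>sides vs. edge_form D D' (q - p))"

text \<open>For alternating \<open>\<omega>\<close> this is the Pfaffian of the 4 by 4 matrix of its
  values; it vanishes if \<open>\<omega>\<close> is a wedge product of two linear forms.\<close>

definition pfaffian4 :: "('d \<Rightarrow> 'd \<Rightarrow> real) \<Rightarrow> 'd \<Rightarrow> 'd \<Rightarrow> 'd \<Rightarrow> 'd \<Rightarrow> real" where
  "pfaffian4 \<omega> A B C D = \<omega> A B * \<omega> C D - \<omega> A C * \<omega> B D + \<omega> A D * \<omega> B C"

lemma pfaffian4_scale: "pfaffian4 (\<lambda>D D'. r * \<omega> D D') A B C E = r * r * pfaffian4 \<omega> A B C E"
  unfolding pfaffian4_def by algebra

lemma triple_minus: "triple (- x) (- y) (- z) = - triple x y z"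
  by (simp add: triple_def cross_minus_left cross_minus_right)

lemma edge_form_minus:
  "derivation_on UNIV D \<Longrightarrow> derivation_on UNIV D' \<Longrightarrow> edge_form D D' (- e) = - edge_form D D' e"
  by (simp add: edge_form_def dvec_simps triple_minus)

lemma edge_form_diff_swap:
  "derivation_on UNIV D \<Longrightarrow> derivation_on UNIV D' \<Longrightarrow> edge_form D D' (p - q) = - edge_form D D' (q - p)"
  using edge_form_minus[of D D' "q - p"] by simp

lemma curve_form_triangle:
  assumes D: "derivation_on UNIV D" "derivation_on UNIV D'"
    and d: "dist p q = 1" "dist q r = 1" "dist r p = 1"
  shows "curve_form D D' [p, q, r] = 0"
proof -
  define u v where "u = q - p" and "v = r - q"
  have s: "p - r = - (u + v)" by (simp add: u_def v_def)
  have unit: "u \<bullet> u = 1" "v \<bullet> v = 1" "(u + v) \<bullet> (u + v) = 1"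
  proof -
    have "u + v = r - p" by (simp add: u_def v_def)
    then show "u \<bullet> u = 1" "v \<bullet> v = 1" "(u + v) \<bullet> (u + v) = 1"
      using d by (simp_all add: u_def v_def dist_norm norm_minus_commute flip: norm_eq_1)
  qed
  have orth: "dvec D u \<bullet> u = 0" "dvec D v \<bullet> v = 0" "(dvec D u + dvec D v) \<bullet> (u + v) = 0"
    if D: "derivation_on UNIV D" for D
    using unit(1,2)[THEN dvec_orthogonal[OF D]] dvec_orthogonal[OF D unit(3)]
    by (simp_all only: dvec_simps(1)[OF D])
  have "edge_form D D' u + edge_form D D' v = edge_form D D' (u + v)"
    unfolding edge_form_def dvec_simps(1)[OF D(1)] dvec_simps(1)[OF D(2)]
    by (rule triple_sum_triangle[OF unit orth[OF D(1)] orth[OF D(2)]])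
  moreover have "edge_form D D' (p - r) = - edge_form D D' (u + v)"
    unfolding s by (rule edge_form_minus[OF D])
  ultimately show ?thesis
    by (simp add: curve_form_def sides_def flip: u_def v_def)
qed

text \<open>The moduli of a nonplanar rhombus are \<open>u \<bullet> v\<close> and \<open>u \<bullet> w\<close> for consecutive edges \<open>u\<close>, \<open>v\<close>, \<open>w\<close>,
  and \<open>\<omega>\<close> is a multiple of the wedge product of their differentials. In a planar rhombus the edges
  form opposite pairs, so that \<open>\<omega>\<close> vanishes.\<close>

lemma pfaffian4_curve_form_rhombus:
  assumes \<rho>: "\<rho> \<in> unit_rhombi"
    and d: "derivation_on UNIV A" "derivation_on UNIV B" "derivation_on UNIV C" "derivation_on UNIV E"
  shows "pfaffian4 (\<lambda>D D'. curve_form D D' \<rho>) A B C E = 0"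
proof -
  obtain p q r s where \<rho>': "\<rho> = [p, q, r, s]"
  proof -
    have "length \<rho> = Suc (Suc (Suc (Suc 0)))" using \<rho> by (simp add: integral_curves_def)
    then show thesis using that by (auto simp: length_Suc_conv)
  qed
  define u v w where "u = q - p" and "v = r - q" and "w = s - r"
  have x: "p - s = - (u + v + w)" by (simp add: u_def v_def w_def)
  have dist: "dist p q = 1" "dist q r = 1" "dist r s = 1" "dist s p = 1"
  proof -
    have "dist (\<rho> ! i) (\<rho> ! (Suc i mod 4)) = 1" if "i < 4" for i
      using \<rho> that by (simp add: integral_curves_def)
    note this[of 0] this[of 1] this[of 2] this[of 3]
    then show "dist p q = 1" "dist q r = 1" "dist r s = 1" "dist s p = 1"
      by (simp_all add: \<rho>')
  qed
  have unit: "u \<bullet> u = 1" "v \<bullet> v = 1" "w \<bullet> w = 1" "(u + v + w) \<bullet> (u + v + w) = 1"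
  proof -
    have "u + v + w = s - p" by (simp add: u_def v_def w_def)
    then show "u \<bullet> u = 1" "v \<bullet> v = 1" "w \<bullet> w = 1" "(u + v + w) \<bullet> (u + v + w) = 1"
      using dist by (simp_all add: u_def v_def w_def dist_norm norm_minus_commute flip: norm_eq_1)
  qed
  have form: "curve_form D D' \<rho> = edge_form D D' u + edge_form D D' v + edge_form D D' w - edge_form D D' (u + v + w)"
    if "derivation_on UNIV D" "derivation_on UNIV D'" for D D'
  proof -
    have "edge_form D D' (p - s) = - edge_form D D' (u + v + w)"
      unfolding x by (rule edge_form_minus[OF that])
    then show ?thesis by (simp add: curve_form_def sides_def \<rho>' flip: u_def v_def w_def)
  qed
  show ?thesis
  proof (cases "triple u v w = 0")
    case True
    have c: "v \<bullet> u = u \<bullet> v" "w \<bullet> u = u \<bullet> w" "w \<bullet> v = v \<bullet> w" by (simp_all add: inner_commute)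
    have vw: "v \<bullet> w = -1 - u \<bullet> v - u \<bullet> w"
      using unit by (simp add: inner_add c)
    have "0 = triple u v w * triple u v w" using True by simp
    \<comment> \<open>The Gram determinant of the three unit vectors factors because their pairwise
      inner products sum to -1. Planarity therefore makes two of the edges opposite.\<close>
    also have "\<dots> = 2 * (1 + u \<bullet> v) * (1 + u \<bullet> w) * (1 + v \<bullet> w)"
      unfolding triple_mult_triple c unit(1-3) vw by algebra
    finally have "1 + u \<bullet> v = 0 \<or> 1 + u \<bullet> w = 0 \<or> 1 + v \<bullet> w = 0"
      unfolding mult_eq_0_iff eq_commute[of 0] by auto
    moreover have opp: "y = - x" if "1 + x \<bullet> y = 0" "x \<bullet> x = 1" "y \<bullet> y = 1" for x y :: "real^3"
    proof -
      have "(x + y) \<bullet> (x + y) = 0" using that by (simp add: inner_add inner_commute[of y x])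
      then show ?thesis by (simp add: eq_neg_iff_add_eq_0 add.commute)
    qed
    ultimately have opp: "v = - u \<or> w = - u \<or> w = - v" using unit by blast
    \<comment> \<open>Once the opposite pair cancels, \<open>u + v + w\<close> equals the remaining
      edge vector, so the other two terms cancel too.\<close>
    have "curve_form D D' \<rho> = 0" if "derivation_on UNIV D" "derivation_on UNIV D'" for D D'
      using opp by (auto simp: form[OF that] edge_form_minus[OF that])
    then show ?thesis using d by (simp add: pfaffian4_def)
  next
    case False
    define d1 d2 where "d1 D = D (u \<bullet> v)" and "d2 D = D (u \<bullet> w)" for D :: "real \<Rightarrow> real"
    have orth: "dvec D u \<bullet> u = 0" "dvec D v \<bullet> v = 0" "dvec D w \<bullet> w = 0"
      "(dvec D u + dvec D v + dvec D w) \<bullet> (u + v + w) = 0" if D: "derivation_on UNIV D" for D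
      using unit(1-3)[THEN dvec_orthogonal[OF D]] dvec_orthogonal[OF D unit(4)]
      by (simp_all only: dvec_simps(1)[OF D])
    have wedge: "triple u v w * curve_form D D' \<rho> = d1 D * d2 D' - d1 D' * d2 D"
      if "derivation_on UNIV D" "derivation_on UNIV D'" for D D'
    proof -
      have "triple u v w * curve_form D D' \<rho> = (dvec D u \<bullet> v + dvec D v \<bullet> u) * (dvec D' u \<bullet> w + dvec D' w \<bullet> u)
         - (dvec D' u \<bullet> v + dvec D' v \<bullet> u) * (dvec D u \<bullet> w + dvec D w \<bullet> u)"
        unfolding form[OF that] edge_form_def dvec_simps(1)[OF that(1)] dvec_simps(1)[OF that(2)]
        by (rule triple_sum_rhombus[OF unit orth[OF that(1)] orth[OF that(2)]])
      then show ?thesis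
        unfolding d1_def d2_def derivation_inner[OF that(1)] derivation_inner[OF that(2)]
        by (simp add: inner_commute add.commute)
    qed
    let ?\<tau> = "triple u v w" and ?\<omega> = "\<lambda>D D'. curve_form D D' \<rho>"
    have "?\<tau> * ?\<tau> * pfaffian4 ?\<omega> A B C E = pfaffian4 (\<lambda>D D'. ?\<tau> * ?\<omega> D D') A B C E"
      by (simp only: pfaffian4_scale)
    \<comment> \<open>The Pluecker relation for the 2 by 2 minors formed from \<open>d1\<close> and
      \<open>d2\<close>.\<close>
    also have "\<dots> = 0"
      unfolding pfaffian4_def wedge[OF d(1,2)] wedge[OF d(1,3)] wedge[OF d(1,4)]
        wedge[OF d(2,3)] wedge[OF d(2,4)] wedge[OF d(3,4)] by algebra
    finally show ?thesis using False by simp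
  qed
qed

section \<open>Cancellation over an orientable dome\<close>

lemma zip_rotate1: "length xs = length ys \<Longrightarrow> zip (rotate1 xs) (rotate1 ys) = rotate1 (zip xs ys)"
  by (cases xs; cases ys) auto

lemma mset_rotate1: "mset (rotate1 xs) = mset xs"
  by (cases xs) auto

text \<open>Reversing a cyclic list also shifts its starting point, so the sides correspond only as
  multisets; this suffices for sums over sides.\<close>

lemma mset_sides_rev: "mset (sides (rev f)) = image_mset prod.swap (mset (sides f))"
proof (cases f rule: rev_cases)
  case (snoc g y)
  then have f: "f = rotate1 (y # g)" by simp
  have "rev (sides (rev f)) = zip (rotate1 (y # g)) (y # g)"
    by (simp add: snoc sides_def flip: zip_rev)
  also have "\<dots> = map prod.swap (sides (y # g))"
    by (simp add: sides_def zip_commute[of "g @ [y]"] prod.swap_def case_prod_beta)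
  finally have "mset (sides (rev f)) = image_mset prod.swap (mset (sides (y # g)))"
    by (metis mset_map mset_rev)
  also have "sides f = rotate1 (sides (y # g))"
    unfolding f sides_def by (rule zip_rotate1) simp
  then have "mset (sides (y # g)) = mset (sides f)" by (simp add: mset_rotate1)
  finally show ?thesis .
qed (simp add: sides_def)

lemma curve_form_rev:
  assumes "derivation_on UNIV D" "derivation_on UNIV D'"
  shows "curve_form D D' (rev f) = - curve_form D D' f"
proof -
  let ?F = "\<lambda>(p, q). edge_form D D' (q - p)"
  have swap: "?F (prod.swap x) = - ?F x" for x
    by (cases x) (simp, rule edge_form_diff_swap[OF assms])
  have "curve_form D D' f = sum_mset (image_mset ?F (mset (sides f)))" for f
    by (simp add: curve_form_def flip: sum_mset_sum_list)
  then have "curve_form D D' (rev f) = sum_mset (image_mset (\<lambda>x. - ?F x) (mset (sides f)))"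
    by (simp only: mset_sides_rev image_mset.compositionality comp_def swap)
  also have "\<dots> = (\<Sum>x\<leftarrow>sides f. - ?F x)"
    by (simp flip: sum_mset_sum_list)
  also have "\<dots> = - curve_form D D' f"
    by (simp add: curve_form_def uminus_sum_list_map comp_def)
  finally show ?thesis .
qed

lemma sides_map: "sides (map g f) = map (map_prod g g) (sides f)"
  by (simp add: sides_def zip_map_map rotate1_map map_prod_def)

lemma sum_list_count_one:
  fixes F :: "'a \<Rightarrow> real"
  assumes "\<And>x. x \<in> set xs \<Longrightarrow> count_list xs x = 1"
  shows "sum_list (map F xs) = sum F (set xs)"
proof -
  have "distinct xs"
    using assms by (auto simp: distinct_count_atmost_1 count_mset count_list_0_iff)
  then show ?thesis by (rule sum_list_distinct_conv_sum_set)
qed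

text \<open>Reversing arcs permutes the index set and changes the sign of every term, so the sum
  equals its own negative.\<close>

lemma sum_arcs_eq_0:
  fixes F :: "'v \<times> 'v \<Rightarrow> real"
  assumes F: "\<And>u v. F (v, u) = - F (u, v)"
  shows "(\<Sum>x\<in>{(u, v). {u, v} \<in> E}. F x) = 0"
proof -
  let ?S = "{(u, v). {u, v} \<in> E}"
  have "sum F ?S = (\<Sum>x\<in>?S. F (prod.swap x))"
    by (rule sum.reindex_bij_witness[where i = prod.swap and j = prod.swap])
      (auto simp: insert_commute)
  also have "\<dots> = - sum F ?S"
    unfolding sum_negf[symmetric]
  proof (rule sum.cong[OF refl])
    show "F (prod.swap x) = - F x" for x by (cases x) (simp, rule F)
  qed
  finally show ?thesis by simp
qed

lemma list_all2_set2_ex: "list_all2 P xs ys \<Longrightarrow> y \<in> set ys \<Longrightarrow> \<exists>x\<in>set xs. P x y"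
  by (induction rule: list_all2_induct) auto

text \<open>Coherently oriented faces traverse each arc exactly once, so their forms sum to zero.
  The triangles contribute nothing, which leaves the two ends. The sign depends only on the
  orientation of the ends, hence one \<open>s\<close> serves all pairs of derivations and can be
  factored out of the Pfaffian.\<close>

lemma orientably_cobordant_curve_form:
  assumes cob: "orientably_cobordant \<gamma> \<eta>"
  shows "\<exists>s\<in>{1, - 1}. \<forall>D D'. derivation_on UNIV D \<longrightarrow> derivation_on UNIV D' \<longrightarrow>
    curve_form D D' \<gamma> = s * curve_form D D' \<eta>"
proof -
  obtain K \<phi> where dome: "orientable_dome [\<gamma>, \<eta>] K \<phi>"
    using cob by (auto simp: orientably_cobordant_def)
  then have unit: "\<And>u v. {u, v} \<in> simplices 1 K \<Longrightarrow> dist (\<phi> u) (\<phi> v) = 1"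
    by (simp add: orientable_dome_def)
  from dome have "\<exists>ts ws. (\<forall>t\<in>set ts. length t = 3) \<and> distinct (map set ts) \<and>
      set ` set ts = simplices 2 K \<and> map (map \<phi>) ws = [\<gamma>, \<eta>] \<and>
      closed_surface (\<Union>K) (simplices 1 K) (ts @ ws) \<and> orientable (simplices 1 K) (ts @ ws)"
    (is "\<exists>ts ws. ?P ts ws")
    unfolding orientable_dome_def by (elim conjE)
  then obtain ts ws where P: "?P ts ws" by (elim exE)
  then have ts: "\<And>t. t \<in> set ts \<Longrightarrow> length t = 3" and ws: "map (map \<phi>) ws = [\<gamma>, \<eta>]"
    and surf: "closed_surface (\<Union>K) (simplices 1 K) (ts @ ws)"
    and ori: "orientable (simplices 1 K) (ts @ ws)"
    by simp_all
  let ?E = "simplices 1 K"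
  obtain w1 w2 where w: "ws = [w1, w2]" "\<gamma> = map \<phi> w1" "\<eta> = map \<phi> w2"
  proof -
    have "length ws = Suc (Suc 0)" using arg_cong[OF ws, of length] by simp
    then obtain w1 w2 where "ws = [w1, w2]" by (auto simp: length_Suc_conv)
    then show thesis using that ws by simp
  qed
  obtain gs where gs: "list_all2 (\<lambda>f g. g = f \<or> g = rev f) (ts @ ws) gs"
    and one: "\<And>u v. {u, v} \<in> ?E \<Longrightarrow> count_list (concat (map sides gs)) (u, v) = 1"
    using ori by (auto simp: orientable_def)
  obtain ts' w1' w2' where gs': "gs = ts' @ [w1', w2']"
    "list_all2 (\<lambda>f g. g = f \<or> g = rev f) ts ts'" "w1' = w1 \<or> w1' = rev w1" "w2' = w2 \<or> w2' = rev w2"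
  proof -
    obtain ts' hs where hs: "gs = ts' @ hs" "list_all2 (\<lambda>f g. g = f \<or> g = rev f) ts ts'"
      "list_all2 (\<lambda>f g. g = f \<or> g = rev f) [w1, w2] hs"
      using gs unfolding w list_all2_append1 by blast
    from hs(3) obtain w1' w2' where "hs = [w1', w2']" "w1' = w1 \<or> w1' = rev w1" "w2' = w2 \<or> w2' = rev w2"
      unfolding list_all2_Cons1 by blast
    with hs(1,2) that show thesis by blast
  qed
  have "\<forall>f\<in>set (ts @ ws). f \<noteq> [] \<and> (\<forall>(u, v)\<in>set (sides f). {u, v} \<in> ?E)"
    using surf unfolding closed_surface_def by (elim conjE)
  then have sidesE: "{u, v} \<in> ?E" if "f \<in> set (ts @ ws)" "(u, v) \<in> set (sides f)" for f u v
    using that by fast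
  have side_rev: "set (sides (rev f)) = prod.swap ` set (sides f)" for f :: "nat list"
    by (metis mset_sides_rev set_image_mset set_mset_mset)
  have gsE: "{u, v} \<in> ?E" if g: "g \<in> set gs" and uv: "(u, v) \<in> set (sides g)" for g u v
  proof -
    obtain f where "f \<in> set (ts @ ws)" "g = f \<or> g = rev f"
      using list_all2_set2_ex[OF gs g] by blast
    then have "f \<in> set (ts @ ws)" "(u, v) \<in> set (sides f) \<or> (v, u) \<in> set (sides f)"
      using uv by (auto simp: side_rev)
    then show ?thesis using sidesE by (metis insert_commute)
  qed
  define S where "S = {(u, v). {u, v} \<in> ?E}"
  have setS: "set (concat (map sides gs)) = S"
  proof
    show "set (concat (map sides gs)) \<subseteq> S" using gsE by (auto simp: S_def)
    show "S \<subseteq> set (concat (map sides gs))"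
    proof
      fix x assume "x \<in> S"
      then have "count_list (concat (map sides gs)) x \<noteq> 0" using one by (auto simp: S_def)
      then show "x \<in> set (concat (map sides gs))" by (simp only: count_list_0_iff not_not)
    qed
  qed
  have sum0: "(\<Sum>g\<leftarrow>gs. curve_form D D' (map \<phi> g)) = 0"
    if D: "derivation_on UNIV D" "derivation_on UNIV D'" for D D'
  proof -
    let ?F = "\<lambda>(u, v). edge_form D D' (\<phi> v - \<phi> u)"
    have "(\<Sum>g\<leftarrow>gs. curve_form D D' (map \<phi> g)) = sum_list (map ?F (concat (map sides gs)))"
      by (induction gs) (simp_all add: curve_form_def sides_map comp_def case_prod_beta)
    also have "\<dots> = sum ?F S"
      unfolding setS[symmetric]
    proof (rule sum_list_count_one)
      fix x assume "x \<in> set (concat (map sides gs))"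
      then have "x \<in> S" using setS by blast
      then show "count_list (concat (map sides gs)) x = 1" using one by (auto simp: S_def)
    qed
    also have "\<dots> = 0"
      unfolding S_def by (rule sum_arcs_eq_0) (simp only: prod.case, rule edge_form_diff_swap[OF D])
    finally show ?thesis .
  qed
  have tri: "curve_form D D' (map \<phi> t) = 0"
    if D: "derivation_on UNIV D" "derivation_on UNIV D'" and t: "t \<in> set ts'" for D D' t
  proof -
    obtain f where f: "f \<in> set ts" "t = f \<or> t = rev f"
      using list_all2_set2_ex[OF gs'(2) t] by blast
    obtain a b c where abc: "f = [a, b, c]"
      using ts[OF f(1)] by (auto simp: length_Suc_conv numeral_eq_Suc)
    have "curve_form D D' (map \<phi> f) = 0"
      unfolding abc list.map using f(1) abc
      by (intro curve_form_triangle[OF D] unit sidesE[of f]) (auto simp: sides_def)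
    then show ?thesis using f(2) curve_form_rev[OF D, of "map \<phi> f"] by (auto simp: rev_map)
  qed
  define s1 s2 :: real where "s1 = (if w1' = w1 then 1 else - 1)" and "s2 = (if w2' = w2 then 1 else - 1)"
  have rel: "s1 * curve_form D D' \<gamma> + s2 * curve_form D D' \<eta> = 0"
    if D: "derivation_on UNIV D" "derivation_on UNIV D'" for D D'
  proof -
    have "(\<Sum>g\<leftarrow>ts'. curve_form D D' (map \<phi> g)) = 0"
      using tri[OF D] by (induction ts') auto
    then have "curve_form D D' (map \<phi> w1') + curve_form D D' (map \<phi> w2') = 0"
      using sum0[OF D] by (simp add: gs')
    moreover have "curve_form D D' (map \<phi> w1') = s1 * curve_form D D' \<gamma>"
      using gs'(3) curve_form_rev[OF D, of "map \<phi> w1"] by (auto simp: s1_def w rev_map)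
    moreover have "curve_form D D' (map \<phi> w2') = s2 * curve_form D D' \<eta>"
      using gs'(4) curve_form_rev[OF D, of "map \<phi> w2"] by (auto simp: s2_def w rev_map)
    ultimately show ?thesis by simp
  qed
  show ?thesis
  proof (intro bexI allI impI)
    \<comment> \<open>Solving the relation for the form of \<open>\<gamma>\<close>, where
      \<open>s1\<close> is its own inverse.\<close>
    show "- s1 * s2 \<in> {1, - 1}" by (auto simp: s1_def s2_def)
    show "curve_form D D' \<gamma> = - s1 * s2 * curve_form D D' \<eta>"
      if "derivation_on UNIV D" "derivation_on UNIV D'" for D D'
      using rel[OF that] by (auto simp: s1_def s2_def split: if_splits)
  qed
qed


section \<open>A generic pentagon\<close>

lemma triple_vector:
  "triple (vector [x1, x2, x3]) (vector [y1, y2, y3]) (vector [z1, z2, z3]) =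
     x1 * (y2 * z3 - y3 * z2) - x2 * (y1 * z3 - y3 * z1) + x3 * (y1 * z2 - y2 * z1)"
  by (simp add: triple_def cross3_def inner_vec_def sum_3 algebra_simps)

lemma dvec_vector: "dvec D (vector [x1, x2, x3]) = vector [D x1, D x2, D x3]"
  by (simp add: dvec_def vec_eq_iff forall_3)

lemma vector_3_diff:
  "(vector [x1, x2, x3] :: real^3) - vector [y1, y2, y3] = vector [x1 - y1, x2 - y2, x3 - y3]"
  by (simp add: vec_eq_iff forall_3)

lemma dist_vector_3:
  assumes "(x1 - y1)\<^sup>2 + (x2 - y2)\<^sup>2 + (x3 - y3)\<^sup>2 = 1"
  shows "dist (vector [x1, x2, x3] :: real^3) (vector [y1, y2, y3]) = 1"
  using assms by (simp add: dist_norm vector_3_diff norm_eq_1 inner_vec_def sum_3 power2_eq_square)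

text \<open>On tangent vectors at a unit vector the triple product is the area form of the sphere.
  In the chart given by the first and third coordinates it is dz wedge dh divided by
  \<open>y\<close>.\<close>

lemma triple_sphere:
  fixes h :: real
  assumes "h * h + y * y + z * z = 1" "h * H + y * Y + z * Z = 0" "h * H' + y * Y' + z * Z' = 0"
  shows "y * triple (vector [h, y, z]) (vector [H, Y, Z]) (vector [H', Y', Z']) = Z * H' - H * Z'"
  using assms unfolding triple_vector by algebra

text \<open>The rotation by an angle with cosine \<open>c\<close> and sine \<open>s\<close> is not constant under the
  derivations; \<open>\<psi>\<close> and \<open>\<psi>'\<close> are the derivatives of the angle.\<close>

lemma triple_rotated:
  fixes c :: real
  assumes "c * c + s * s = 1"
    and "x1 * x1 + x2 * x2 + x3 * x3 = 1" "x1 * X1 + x2 * X2 + x3 * X3 = 0" "x1 * Y1 + x2 * Y2 + x3 * Y3 = 0"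
  shows "triple (vector [c * x1 - s * x2, s * x1 + c * x2, x3])
      (vector [c * (X1 - \<psi> * x2) - s * (X2 + \<psi> * x1), s * (X1 - \<psi> * x2) + c * (X2 + \<psi> * x1), X3])
      (vector [c * (Y1 - \<psi>' * x2) - s * (Y2 + \<psi>' * x1), s * (Y1 - \<psi>' * x2) + c * (Y2 + \<psi>' * x1), Y3])
    = triple (vector [x1, x2, x3]) (vector [X1, X2, X3]) (vector [Y1, Y2, Y3]) + \<psi> * Y3 - \<psi>' * X3"
proof -
  have rot: "triple (vector [c * u1 - s * u2, s * u1 + c * u2, u3]) (vector [c * v1 - s * v2, s * v1 + c * v2, v3])
      (vector [c * w1 - s * w2, s * w1 + c * w2, w3]) = triple (vector [u1, u2, u3]) (vector [v1, v2, v3]) (vector [w1, w2, w3])"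
    for u1 u2 u3 v1 v2 v3 w1 w2 w3
    using assms(1) unfolding triple_vector by algebra
  show ?thesis
    unfolding rot using assms(2-4) unfolding triple_vector by algebra
qed

text \<open>The correction is the wedge product of the angle differential
  \<open>c * D s - s * D c\<close> with the differential of the height \<open>x3\<close>. Opposite
  heights will therefore cancel it.\<close>

lemma edge_form_rotated:
  assumes D: "derivation_on UNIV D" "derivation_on UNIV D'"
    and cs: "c * c + s * s = 1" and x: "x1 * x1 + x2 * x2 + x3 * x3 = 1"
  shows "edge_form D D' (vector [c * x1 - s * x2, s * x1 + c * x2, x3]) =
    edge_form D D' (vector [x1, x2, x3]) + (c * D s - s * D c) * D' x3 - (c * D' s - s * D' c) * D x3"
proof -
  \<comment> \<open>Differentiating \<open>c * c + s * s = 1\<close> makes the derivative of (c, s)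
    a multiple of (-s, c).\<close>
  have dcs: "D c = - s * (c * D s - s * D c)" "D s = c * (c * D s - s * D c)" if D: "derivation_on UNIV D" for D
  proof -
    have "c * D c + s * D s = 0"
      using arg_cong[OF cs, of D] by (simp add: derivation_UNIV[OF D])
    then show "D c = - s * (c * D s - s * D c)" "D s = c * (c * D s - s * D c)" using cs by algebra+
  qed
  have dx: "x1 * D x1 + x2 * D x2 + x3 * D x3 = 0" if D: "derivation_on UNIV D" for D
    using arg_cong[OF x, of D] by (simp add: derivation_UNIV[OF D])
  have rot: "dvec D (vector [c * x1 - s * x2, s * x1 + c * x2, x3]) =
     vector [c * (D x1 - (c * D s - s * D c) * x2) - s * (D x2 + (c * D s - s * D c) * x1),
        s * (D x1 - (c * D s - s * D c) * x2) + c * (D x2 + (c * D s - s * D c) * x1), D x3]"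
    if D: "derivation_on UNIV D" for D
  proof -
    have "D (c * x1 - s * x2) = c * (D x1 - (c * D s - s * D c) * x2) - s * (D x2 + (c * D s - s * D c) * x1)"
      "D (s * x1 + c * x2) = s * (D x1 - (c * D s - s * D c) * x2) + c * (D x2 + (c * D s - s * D c) * x1)"
      unfolding derivation_UNIV[OF D] using dcs[OF D] by algebra+
    then show ?thesis by (simp add: dvec_vector)
  qed
  show ?thesis
    unfolding edge_form_def rot[OF D(1)] rot[OF D(2)]
    unfolding dvec_vector
    by (rule triple_rotated[OF cs x dx[OF D(1)] dx[OF D(2)]])
qed

text \<open>The map is a half turn about the first axis, a rotation with constant matrix.\<close>

lemma edge_form_reflect:
  "derivation_on UNIV D \<Longrightarrow> derivation_on UNIV D' \<Longrightarrow>
    edge_form D D' (vector [x1, - x2, - x3]) = edge_form D D' (vector [x1, x2, x3])"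
  by (simp add: edge_form_def dvec_vector triple_vector derivation_UNIV algebra_simps)

lemma edge_form_planar: "derivation_on UNIV D \<Longrightarrow> derivation_on UNIV D' \<Longrightarrow> edge_form D D' (vector [x1, x2, 0]) = 0"
  by (simp add: edge_form_def dvec_vector triple_vector derivation_UNIV)

text \<open>Two isosceles triangles with unit legs, having apexes \<open>(h, y, z)\<close> and
  \<open>(c k - s m, s k + c m, w)\<close>, are attached to two sides of a planar triangle whose third side has
  unit length. The second one is rotated by the angle between the two sides.\<close>

definition pentagon :: "real \<Rightarrow> real \<Rightarrow> real \<Rightarrow> real \<Rightarrow> real \<Rightarrow> real \<Rightarrow> real \<Rightarrow> real \<Rightarrow> (real^3) list" where
  "pentagon h y z k m w c s = [vector [0, 0, 0], vector [h, y, z], vector [2 * h, 0, 0],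
     vector [2 * c * k, 2 * s * k, 0], vector [c * k - s * m, s * k + c * m, w]]"

context
  fixes h y z k m w c s :: real
  assumes hyz: "h * h + y * y + z * z = 1" and kmw: "k * k + m * m + w * w = 1"
    and cs: "c * c + s * s = 1" and hk: "4 * h * h + 4 * k * k - 8 * c * h * k = 1"
begin

text \<open>The legs are unit by \<open>hyz\<close> and \<open>kmw\<close>, the rotation preserving
  length by \<open>cs\<close>. Assumption \<open>hk\<close> is the law of cosines for the planar
  triangle with sides \<open>2 * h\<close>, \<open>2 * k\<close> and 1.\<close>

lemma pentagon_integral: "pentagon h y z k m w c s \<in> integral_curves 5" (is "?vs \<in> _")
proof -
  have "dist (vector [0, 0, 0] :: real^3) (vector [h, y, z]) = 1"
    "dist (vector [h, y, z] :: real^3) (vector [2 * h, 0, 0]) = 1"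
    "dist (vector [2 * h, 0, 0] :: real^3) (vector [2 * c * k, 2 * s * k, 0]) = 1"
    "dist (vector [2 * c * k, 2 * s * k, 0] :: real^3) (vector [c * k - s * m, s * k + c * m, w]) = 1"
    "dist (vector [c * k - s * m, s * k + c * m, w] :: real^3) (vector [0, 0, 0]) = 1"
    subgoal using hyz by (intro dist_vector_3; algebra)
    subgoal using hyz by (intro dist_vector_3; algebra)
    subgoal
    proof (rule dist_vector_3)
      have "(2 * h - 2 * c * k)\<^sup>2 + (0 - 2 * s * k)\<^sup>2 + (0 - 0)\<^sup>2 =
          4 * h * h + 4 * k * k * (c * c + s * s) - 8 * c * h * k"
        by (simp add: power2_eq_square algebra_simps)
      then show "(2 * h - 2 * c * k)\<^sup>2 + (0 - 2 * s * k)\<^sup>2 + (0 - 0)\<^sup>2 = 1" using cs hk by simp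
    qed
    subgoal
    proof (rule dist_vector_3)
      have "(2 * c * k - (c * k - s * m))\<^sup>2 + (2 * s * k - (s * k + c * m))\<^sup>2 + (0 - w)\<^sup>2 =
          (c * c + s * s) * (k * k + m * m) + w * w"
        by (simp add: power2_eq_square algebra_simps)
      then show "(2 * c * k - (c * k - s * m))\<^sup>2 + (2 * s * k - (s * k + c * m))\<^sup>2 + (0 - w)\<^sup>2 = 1"
        using cs kmw by simp
    qed
    subgoal
    proof (rule dist_vector_3)
      have "(c * k - s * m - 0)\<^sup>2 + (s * k + c * m - 0)\<^sup>2 + (w - 0)\<^sup>2 =
          (c * c + s * s) * (k * k + m * m) + w * w"
        by (simp add: power2_eq_square algebra_simps)
      then show "(c * k - s * m - 0)\<^sup>2 + (s * k + c * m - 0)\<^sup>2 + (w - 0)\<^sup>2 = 1"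
        using cs kmw by simp
    qed
    done
  note edges = this
  have "dist (?vs ! i) (?vs ! (Suc i mod 5)) = 1" if "i < 5" for i
  proof -
    from that consider "i = 0" | "i = 1" | "i = 2" | "i = 3" | "i = 4" by linarith
    then show ?thesis using edges by cases (simp_all add: pentagon_def)
  qed
  then show ?thesis by (simp add: integral_curves_def) (simp add: pentagon_def)
qed

text \<open>The two legs of each isosceles triangle contribute equally, by the half turn, and the
  planar edge contributes nothing. The angle corrections of the rotated legs cancel because their
  heights are \<open>w\<close> and \<open>- w\<close>. In the coordinates \<open>h\<close>,
  \<open>z\<close>, \<open>k\<close>, \<open>w\<close> the form thus splits into two area
  forms.\<close>

lemma curve_form_pentagon:
  assumes D: "derivation_on UNIV D" "derivation_on UNIV D'"
  shows "y * m * curve_form D D' (pentagon h y z k m w c s) =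
    2 * m * (D z * D' h - D h * D' z) - 2 * y * (D w * D' k - D k * D' w)"
proof -
  let ?F = "edge_form D D'"
  have "curve_form D D' (pentagon h y z k m w c s) =
      ?F (vector [h, y, z]) + ?F (vector [h, - y, - z]) + ?F (vector [2 * c * k - 2 * h, 2 * s * k, 0])
      + ?F (- vector [c * k - s * (- m), s * k + c * (- m), - w])
      + ?F (- vector [c * k - s * m, s * k + c * m, w])"
  proof -
    have "- vector [x1, x2, x3] = (vector [- x1, - x2, - x3] :: real^3)" for x1 x2 x3
      by (simp add: vec_eq_iff forall_3)
    then show ?thesis
      by (simp add: curve_form_def pentagon_def sides_def vector_3_diff algebra_simps)
  qed
  also have "\<dots> = 2 * ?F (vector [h, y, z]) - 2 * ?F (vector [k, m, w])"
    unfolding edge_form_minus[OF D] edge_form_planar[OF D]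
    using edge_form_rotated[OF D cs, of k m w] edge_form_rotated[OF D cs, of k "- m" "- w"] kmw
    by (simp add: edge_form_reflect[OF D] derivation_UNIV[OF D(1)] derivation_UNIV[OF D(2)])
  finally have "y * m * curve_form D D' (pentagon h y z k m w c s) =
    2 * m * (y * ?F (vector [h, y, z])) - 2 * y * (m * ?F (vector [k, m, w]))" by algebra
  moreover have "h * D h + y * D y + z * D z = 0" "k * D k + m * D m + w * D w = 0"
    if D: "derivation_on UNIV D" for D
    using arg_cong[OF hyz, of D] arg_cong[OF kmw, of D] by (simp_all add: derivation_UNIV[OF D])
  ultimately show ?thesis
    using D hyz kmw by (simp add: edge_form_def dvec_vector triple_sphere)
qed

end

section \<open>Independent derivations and a nonzero Pfaffian\<close>

text \<open>Each parameter is transcendental over the ring generated by the earlier ones, and its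
  derivation kills that ring. The rings stay countable, so the choice can be repeated. Values on
  later parameters are left open: the resulting matrix is triangular with unit diagonal.\<close>

lemma triangular_derivations:
  fixes l1 r1 l2 r2 l3 r3 l4 r4 :: real
  assumes "l1 < r1" "l2 < r2" "l3 < r3" "l4 < r4"
  obtains t1 t2 t3 t4 :: real and D1 D2 D3 D4 where
    "l1 < t1" "t1 < r1" "l2 < t2" "t2 < r2" "l3 < t3" "t3 < r3" "l4 < t4" "t4 < r4"
    "derivation_on UNIV D1" "derivation_on UNIV D2" "derivation_on UNIV D3" "derivation_on UNIV D4"
    "D1 t1 = 1" "D2 t1 = 0" "D2 t2 = 1" "D3 t1 = 0" "D3 t2 = 0" "D3 t3 = 1"
    "D4 t1 = 0" "D4 t2 = 0" "D4 t3 = 0" "D4 t4 = 1"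
proof -
  have step: "\<exists>t D. l < t \<and> t < r \<and> derivation_on UNIV D \<and> (\<forall>a\<in>A. D a = 0) \<and> D t = 1"
    if "subring_of A" "countable A" "l < r" for A and l r :: real
    using transcendental_over_exists[OF that(2,3)] derivation_transcendental[OF that(1)] by metis
  have A0: "subring_of (\<int> :: real set)" "countable (\<int> :: real set)"
    by (auto simp: subring_of_def) (simp add: Ints_def)
  obtain t1 D1 where 1: "l1 < t1" "t1 < r1" "derivation_on UNIV D1" "D1 t1 = 1"
    using step[OF A0 assms(1)] by blast
  define A1 where "A1 = adjoin (\<int> :: real set) t1"
  have A1: "subring_of A1" "countable A1" "t1 \<in> A1"
    using A0 by (simp_all add: A1_def subring_of_adjoin countable_adjoin adjoin_supset)
  obtain t2 D2 where 2: "l2 < t2" "t2 < r2" "derivation_on UNIV D2" "\<forall>a\<in>A1. D2 a = 0" "D2 t2 = 1"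
    using step[OF A1(1,2) assms(2)] by blast
  define A2 where "A2 = adjoin A1 t2"
  have A2: "subring_of A2" "countable A2" "t2 \<in> A2" "A1 \<subseteq> A2"
    using A1 by (simp_all add: A2_def subring_of_adjoin countable_adjoin adjoin_supset)
  obtain t3 D3 where 3: "l3 < t3" "t3 < r3" "derivation_on UNIV D3" "\<forall>a\<in>A2. D3 a = 0" "D3 t3 = 1"
    using step[OF A2(1,2) assms(3)] by blast
  define A3 where "A3 = adjoin A2 t3"
  have A3: "subring_of A3" "countable A3" "t3 \<in> A3" "A2 \<subseteq> A3"
    using A2 by (simp_all add: A3_def subring_of_adjoin countable_adjoin adjoin_supset)
  obtain t4 D4 where 4: "l4 < t4" "t4 < r4" "derivation_on UNIV D4" "\<forall>a\<in>A3. D4 a = 0" "D4 t4 = 1"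
    using step[OF A3(1,2) assms(4)] by blast
  show thesis
    by (rule that[of t1 t2 t3 t4 D1 D2 D3 D4]) (use 1 2 3 4 A1 A2 A3 in auto)
qed

lemma pentagon_pfaffian4_nonzero:
  obtains \<gamma> A B C E where "\<gamma> \<in> integral_curves 5"
    "derivation_on UNIV A" "derivation_on UNIV B" "derivation_on UNIV C" "derivation_on UNIV E"
    "pfaffian4 (\<lambda>D D'. curve_form D D' \<gamma>) A B C E \<noteq> 0"
proof -
  \<comment> \<open>These ranges make both radicands for \<open>y\<close> and \<open>m\<close>
    positive and place \<open>c\<close> between 0 and 1.\<close>
  obtain h z k w :: real and A B C E where
    bounds: "1/2 < h" "h < 6/10" "0 < z" "z < 1/10" "1/2 < k" "k < 6/10" "0 < w" "w < 1/10"
    and der: "derivation_on UNIV A" "derivation_on UNIV B" "derivation_on UNIV C" "derivation_on UNIV E"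
    and vals: "A h = 1" "B h = 0" "B z = 1" "C h = 0" "C z = 0" "C k = 1" "E h = 0" "E z = 0" "E k = 0" "E w = 1"
    by (rule triangular_derivations[of "1/2" "6/10" 0 "1/10" "1/2" "6/10" 0 "1/10"]) auto
  define y where "y = sqrt (1 - h * h - z * z)"
  define m where "m = sqrt (1 - k * k - w * w)"
  \<comment> \<open>The law of cosines, solved for the angle between the sides \<open>2 * h\<close>
    and \<open>2 * k\<close>.\<close>
  define c where "c = (4 * h * h + 4 * k * k - 1) / (8 * h * k)"
  define s where "s = sqrt (1 - c * c)"
  have sq: "x * x < 36/100" if "1/2 < x" "x < 6/10" for x :: real
    using mult_strict_mono[of x "6/10" x "6/10"] that by simp
  have sq': "x * x < 1/100" if "0 < x" "x < 1/10" for x :: real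
    using mult_strict_mono[of x "1/10" x "1/10"] that by simp
  have "0 < 1 - h * h - z * z" "0 < 1 - k * k - w * w"
    using sq[of h] sq[of k] sq'[of z] sq'[of w] bounds by linarith+
  then have y: "0 < y" "h * h + y * y + z * z = 1" and m: "0 < m" "k * k + m * m + w * w = 1"
    by (simp_all add: y_def m_def)
  have hk: "0 < 8 * h * k" using bounds by simp
  \<comment> \<open>The bound \<open>c \<le> 1\<close> amounts to
    \<open>4 * (h - k) * (h - k) \<le> 1\<close>.\<close>
  have "(h - k) * (h - k) \<le> 1/100"
  proof -
    have "h - k \<le> 1/10" "- (h - k) \<le> 1/10" using bounds by linarith+
    then have "\<bar>h - k\<bar> \<le> \<bar>1/10 :: real\<bar>" by (simp only: abs_le_iff) simp
    then show ?thesis unfolding abs_le_square_iff by (simp add: power2_eq_square)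
  qed
  then have "4 * h * h + 4 * k * k - 1 \<le> 8 * h * k" by (simp add: algebra_simps)
  then have "c \<le> 1" using hk by (simp add: c_def)
  moreover have "1/4 \<le> h * h" "1/4 \<le> k * k"
    using mult_mono[of "1/2" h "1/2" h] mult_mono[of "1/2" k "1/2" k] bounds by simp_all
  then have "0 \<le> c" using hk by (simp add: c_def)
  ultimately have "c * c \<le> 1" using mult_mono[of c 1 c 1] by simp
  then have cs: "c * c + s * s = 1" by (simp add: s_def)
  have "c * (8 * h * k) = 4 * h * h + 4 * k * k - 1"
    using hk c_def eq_divide_eq[of c _ "8 * h * k"] by (metis less_irrefl)
  then have chk: "4 * h * h + 4 * k * k - 8 * c * h * k = 1" by (simp add: algebra_simps)
  let ?\<gamma> = "pentagon h y z k m w c s"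
  let ?\<omega> = "\<lambda>D D'. curve_form D D' ?\<gamma>"
  note form = curve_form_pentagon[OF y(2) m(2) cs chk]
  have "(y * m) * (y * m) * pfaffian4 ?\<omega> A B C E = pfaffian4 (\<lambda>D D'. y * m * ?\<omega> D D') A B C E"
    by (simp only: pfaffian4_scale)
  \<comment> \<open>The terms involving only \<open>k\<close> and \<open>w\<close> cancel by the
    Pluecker relation. In the mixed part triangularity removes the unspecified values, leaving the
    product of \<open>- 2 * m\<close> and \<open>2 * y\<close>.\<close>
  also have "\<dots> = - 4 * (y * m)"
    unfolding pfaffian4_def form[OF der(1,2)] form[OF der(1,3)] form[OF der(1,4)]
      form[OF der(2,3)] form[OF der(2,4)] form[OF der(3,4)] vals
    by (simp add: algebra_simps)
  also have "\<dots> \<noteq> 0" using y(1) m(1) by simp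
  finally have "pfaffian4 ?\<omega> A B C E \<noteq> 0" by auto
  with pentagon_integral[OF y(2) m(2) cs chk] der show thesis
    by (intro that[of ?\<gamma> A B C E])
qed

theorem theorem1p2:
  shows "\<exists>\<gamma>\<in>integral_curves 5. \<forall>\<rho>\<in>unit_rhombi. \<not> orientably_cobordant \<gamma> \<rho>"
proof -
  obtain \<gamma> A B C E where \<gamma>: "\<gamma> \<in> integral_curves 5"
    and d: "derivation_on UNIV A" "derivation_on UNIV B" "derivation_on UNIV C" "derivation_on UNIV E"
    and nonzero: "pfaffian4 (\<lambda>D D'. curve_form D D' \<gamma>) A B C E \<noteq> 0"
    by (rule pentagon_pfaffian4_nonzero)
  have "\<not> orientably_cobordant \<gamma> \<rho>" if \<rho>: "\<rho> \<in> unit_rhombi" for \<rho>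
  proof
    assume "orientably_cobordant \<gamma> \<rho>"
    then obtain s where eq: "\<And>D D'. derivation_on UNIV D \<Longrightarrow> derivation_on UNIV D' \<Longrightarrow>
        curve_form D D' \<gamma> = s * curve_form D D' \<rho>"
      using orientably_cobordant_curve_form by blast
    have "pfaffian4 (\<lambda>D D'. curve_form D D' \<gamma>) A B C E
        = pfaffian4 (\<lambda>D D'. s * curve_form D D' \<rho>) A B C E"
      unfolding pfaffian4_def using d by (simp only: eq)
    also have "\<dots> = 0"
      unfolding pfaffian4_scale pfaffian4_curve_form_rhombus[OF \<rho> d] by simp
    finally show False using nonzero by simp
  qed
  then show ?thesis using \<gamma> by blast
qed

end
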